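(* On $\mathrm{U}(3)$ with the left-invariant Riemannian metric $g$ described in the context, each of the vector fields $\xi_1,\xi_2,\xi_3$ is Killing with respect to $g$.
   Context: Let $E_{ij}$ be the elementary $3\times3$ matrices. On the Lie group $\mathrm{U}(3)$ let $X_{ij},Y_{ij}$ for $(ij)\in\{(12),(13),(23)\}$ and $\xi_1,\xi_2,\xi_3$ be the left-invariant vector fields with values at the identity $X_{ij}=E_{ij}-E_{ji}$, $Y_{ij}=\sqrt{-1}(E_{ij}+E_{ji})$, $\xi_i=\sqrt{-1}E_{ii}$. Let $g$ be the left-invariant Riemannian metric making $\{X_{12},Y_{12},X_{13},Y_{13},X_{23},Y_{23},\xi_1,\xi_2,\xi_3\}$ orthonormal. *)

theory Defs
  imports "HOL-Analysis.Analysis"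
begin

section \<open>Calculus on submanifolds of a Euclidean space\<close>

text \<open>
  A manifold is a subset \<open>M\<close> of a Euclidean space, to be thought of as an embedded submanifold.
  Its tangent vectors are vectors of the ambient space. Vector fields and
  metrics are functions on the whole ambient space of which only the values on \<open>M\<close>
  (and on the tangent spaces of \<open>M\<close>) matter.
\<close>

text \<open>\<open>Ck_on k U f\<close> is meant for open \<open>U\<close>.\<close>

primrec Ck_on :: "nat \<Rightarrow> 'a::euclidean_space set \<Rightarrow> ('a \<Rightarrow> 'b::euclidean_space) \<Rightarrow> bool" where
  "Ck_on 0 U f \<longleftrightarrow> continuous_on U f"
| "Ck_on (Suc k) U f \<longleftrightarrow>
     (\<forall>x\<in>U. f differentiable (at x)) \<and> (\<forall>v. Ck_on k U (\<lambda>x. frechet_derivative f (at x) v))"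

definition smooth_on :: "'a::euclidean_space set \<Rightarrow> ('a \<Rightarrow> 'b::euclidean_space) \<Rightarrow> bool" where
  "smooth_on M f \<longleftrightarrow>
     (\<forall>p\<in>M. \<exists>U F. open U \<and> p \<in> U \<and> (\<forall>k. Ck_on k U F) \<and> (\<forall>q\<in>M \<inter> U. F q = f q))"

definition tangent_space :: "'a::euclidean_space set \<Rightarrow> 'a \<Rightarrow> 'a set" where
  "tangent_space M p =
     {v. \<exists>\<gamma> e. e > 0 \<and> smooth_on {-e<..<e} \<gamma> \<and> \<gamma> ` {-e<..<e} \<subseteq> M \<and> \<gamma> 0 = p \<and>
           (\<gamma> has_vector_derivative v) (at (0::real))}"

text \<open>
  The derivative of \<open>f\<close> at \<open>p \<in> M\<close> in the tangent direction \<open>v\<close>. A derivative of \<open>f\<close> within \<open>M\<close>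
  is in general not unique as a linear map on the ambient space, but its values on
  tangent vectors are, as the lemma below shows.
\<close>

definition dir_deriv ::
    "'a::euclidean_space set \<Rightarrow> ('a \<Rightarrow> 'b::euclidean_space) \<Rightarrow> 'a \<Rightarrow> 'a \<Rightarrow> 'b" where
  "dir_deriv M f p v = frechet_derivative f (at p within M) v"

lemma dir_deriv_eq:
  assumes f: "(f has_derivative f') (at p within M)" and v: "v \<in> tangent_space M p"
  shows "dir_deriv M f p v = f' v"
proof -
  obtain \<gamma> e where e: "e > 0" and sub: "\<gamma> ` {-e<..<e} \<subseteq> M" and \<gamma>0: "\<gamma> 0 = p"
    and \<gamma>: "(\<gamma> has_vector_derivative v) (at (0::real))"
    using v unfolding tangent_space_def by blast
  have \<gamma>': "(\<gamma> has_derivative (\<lambda>t. t *\<^sub>R v)) (at 0 within {-e<..<e})"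
    using \<gamma> unfolding has_vector_derivative_def by (rule has_derivative_at_withinI)
  have at: "at (0::real) within {-e<..<e} = at 0"
    using e by (intro at_within_open) auto
  have curve: "((f \<circ> \<gamma>) has_vector_derivative h v) (at 0)"
    if h: "(f has_derivative h) (at p within M)" for h
  proof -
    have "(f has_derivative h) (at (\<gamma> 0) within \<gamma> ` {-e<..<e})"
      using has_derivative_subset[OF h sub] \<gamma>0 by simp
    from diff_chain_within[OF \<gamma>' this]
    have "((f \<circ> \<gamma>) has_derivative (\<lambda>t. h (t *\<^sub>R v))) (at 0)"
      by (simp add: at o_def)
    moreover have "linear h"
      using h by (rule has_derivative_linear)
    ultimately show ?thesis
      by (simp add: has_vector_derivative_def linear_scale)
  qed
  have "(f has_derivative frechet_derivative f (at p within M)) (at p within M)"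
    using f frechet_derivative_works differentiable_def by blast
  then show ?thesis
    using curve f vector_derivative_unique_at unfolding dir_deriv_def by blast
qed

definition smooth_vector_field :: "'a::euclidean_space set \<Rightarrow> ('a \<Rightarrow> 'a) \<Rightarrow> bool" where
  "smooth_vector_field M X \<longleftrightarrow> smooth_on M X \<and> (\<forall>p\<in>M. X p \<in> tangent_space M p)"

text \<open>
  In components this is the usual coordinate formula \<open>[X,Y]\<^sup>i = X(Y\<^sup>i) - Y(X\<^sup>i)\<close>, taken with
  respect to the linear coordinates of the ambient space.
\<close>

definition lie_bracket ::
    "'a::euclidean_space set \<Rightarrow> ('a \<Rightarrow> 'a) \<Rightarrow> ('a \<Rightarrow> 'a) \<Rightarrow> 'a \<Rightarrow> 'a" where
  "lie_bracket M X Y p = dir_deriv M Y p (X p) - dir_deriv M X p (Y p)"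

definition riemannian_metric ::
    "'a::euclidean_space set \<Rightarrow> ('a \<Rightarrow> 'a \<Rightarrow> 'a \<Rightarrow> real) \<Rightarrow> bool" where
  "riemannian_metric M g \<longleftrightarrow>
     (\<forall>p\<in>M.
        (\<forall>u\<in>tangent_space M p. \<forall>v\<in>tangent_space M p. g p u v = g p v u) \<and>
        (\<forall>u\<in>tangent_space M p. \<forall>v\<in>tangent_space M p. \<forall>w\<in>tangent_space M p.
           g p (u + v) w = g p u w + g p v w) \<and>
        (\<forall>c. \<forall>u\<in>tangent_space M p. \<forall>v\<in>tangent_space M p. g p (c *\<^sub>R u) v = c * g p u v) \<and>
        (\<forall>u\<in>tangent_space M p. u \<noteq> 0 \<longrightarrow> g p u u > 0)) \<and>
     (\<forall>Y Z. smooth_vector_field M Y \<longrightarrow> smooth_vector_field M Z \<longrightarrow>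
        smooth_on M (\<lambda>p. g p (Y p) (Z p)))"

text \<open>\<open>(L\<^sub>X g)(Y, Z) = X(g(Y, Z)) - g([X, Y], Z) - g(Y, [X, Z])\<close>\<close>

definition lie_derivative_metric ::
    "'a::euclidean_space set \<Rightarrow> ('a \<Rightarrow> 'a) \<Rightarrow> ('a \<Rightarrow> 'a \<Rightarrow> 'a \<Rightarrow> real) \<Rightarrow>
      ('a \<Rightarrow> 'a) \<Rightarrow> ('a \<Rightarrow> 'a) \<Rightarrow> 'a \<Rightarrow> real" where
  "lie_derivative_metric M X g Y Z p =
     dir_deriv M (\<lambda>q. g q (Y q) (Z q)) p (X p)
     - g p (lie_bracket M X Y p) (Z p) - g p (Y p) (lie_bracket M X Z p)"

definition killing_field ::
    "'a::euclidean_space set \<Rightarrow> ('a \<Rightarrow> 'a \<Rightarrow> 'a \<Rightarrow> real) \<Rightarrow> ('a \<Rightarrow> 'a) \<Rightarrow> bool" where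
  "killing_field M g X \<longleftrightarrow>
     smooth_vector_field M X \<and>
     (\<forall>Y Z. smooth_vector_field M Y \<longrightarrow> smooth_vector_field M Z \<longrightarrow>
        (\<forall>p\<in>M. lie_derivative_metric M X g Y Z p = 0))"


section \<open>The unitary group \<open>U(3)\<close>\<close>

definition U3 :: "(complex^3^3) set" where
  "U3 = {A. A ** transpose (map_matrix cnj A) = mat 1}"

definition Emat :: "3 \<Rightarrow> 3 \<Rightarrow> complex^3^3" where
  "Emat i j = (\<chi> k l. if k = i \<and> l = j then 1 else 0)"

definition Xmat :: "3 \<Rightarrow> 3 \<Rightarrow> complex^3^3" where
  "Xmat i j = Emat i j - Emat j i"

definition Ymat :: "3 \<Rightarrow> 3 \<Rightarrow> complex^3^3" where
  "Ymat i j = map_matrix ((*) \<i>) (Emat i j + Emat j i)"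

definition ximat :: "3 \<Rightarrow> complex^3^3" where
  "ximat i = map_matrix ((*) \<i>) (Emat i i)"

text \<open>
  The left-invariant vector field with value \<open>v\<close> at the identity: left translation by \<open>A\<close> is the
  restriction of the linear map \<open>B \<mapsto> A ** B\<close>, so its differential is \<open>v \<mapsto> A ** v\<close>.
\<close>

definition left_field :: "complex^3^3 \<Rightarrow> complex^3^3 \<Rightarrow> complex^3^3" where
  "left_field v = (\<lambda>A. A ** v)"

definition left_invariant_metric ::
    "(complex^3^3 \<Rightarrow> complex^3^3 \<Rightarrow> complex^3^3 \<Rightarrow> real) \<Rightarrow> bool" where
  "left_invariant_metric g \<longleftrightarrow>
     (\<forall>A\<in>U3. \<forall>B\<in>U3. \<forall>u\<in>tangent_space U3 B. \<forall>v\<in>tangent_space U3 B.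
        g (A ** B) (A ** u) (A ** v) = g B u v)"

definition frame :: "(complex^3^3 \<Rightarrow> complex^3^3) set" where
  "frame = left_field `
     {Xmat 1 2, Ymat 1 2, Xmat 1 3, Ymat 1 3, Xmat 2 3, Ymat 2 3, ximat 1, ximat 2, ximat 3}"

definition frame_orthonormal ::
    "(complex^3^3 \<Rightarrow> complex^3^3 \<Rightarrow> complex^3^3 \<Rightarrow> real) \<Rightarrow> bool" where
  "frame_orthonormal g \<longleftrightarrow>
     (\<forall>V\<in>frame. \<forall>W\<in>frame. \<forall>A\<in>U3. g A (V A) (W A) = (if V = W then 1 else 0))"

end

theory Submission
  imports Defs
begin

text \<open>
  Left translations identify every tangent space of \<open>U(3)\<close> with the Lie algebra \<open>u(3)\<close> of
  skew-Hermitian matrices: \<open>T\<^sub>A U(3) = A u(3)\<close> (\<open>tangent_space_U3\<close>). The given matrices are a basis of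
  \<open>u(3)\<close>, so a metric for which the frame is orthonormal is determined:
  \<open>g\<^sub>A(u, v) = \<langle>A\<^sup>* u, A\<^sup>* v\<rangle>\<close>, where \<open>\<langle>a, b\<rangle>\<close> is the sum of \<open>Re (cnj a\<^sub>i\<^sub>j * b\<^sub>i\<^sub>j)\<close> over \<open>i \<le> j\<close>
  (\<open>metric_eq_u3_inner\<close>).

  For a field \<open>Y\<close> put \<open>y(q) = q\<^sup>* Y(q)\<close>, a function with values in \<open>u(3)\<close>, and let \<open>X(q) = q \<xi>\<close>.
  The derivative of \<open>y\<close> along \<open>X\<close> and the bracket are related by \<open>q\<^sup>* [X, Y] = X(y) + [\<xi>, y]\<close>
  (\<open>left_trivialisation_derivative\<close>). By the product rule \<open>X(g(Y, Z)) = \<langle>X(y), z\<rangle> + \<langle>y, X(z)\<rangle>\<close>,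
  the Lie derivative of \<open>g\<close> is therefore
  \<open>(L\<^sub>X g)(Y, Z) = - \<langle>[\<xi>, y], z\<rangle> - \<langle>y, [\<xi>, z]\<rangle>\<close>, and \<open>X\<close> is Killing as soon as \<open>ad \<xi>\<close> is
  skew-adjoint (\<open>killing_field_left_field\<close>).

  This is the case for \<open>\<xi> = \<xi>\<^sub>k\<close>: the matrix is diagonal with imaginary entries, so \<open>ad \<xi>\<close> multiplies
  each matrix entry by an imaginary number, and the inner product treats the entries separately
  (\<open>ad_ximat_skew_adjoint\<close>).
\<close>

section \<open>Functions of class C^k\<close>

lemma Ck_on_cong:
  assumes "open U" and "\<And>x. x \<in> U \<Longrightarrow> f x = g x"
  shows "Ck_on k U f \<longleftrightarrow> Ck_on k U g"
proof -
  have imp: "Ck_on k U g'" if "Ck_on k U f'" and eq: "\<And>x. x \<in> U \<Longrightarrow> f' x = g' x"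
    for f' g' :: "'a \<Rightarrow> 'b"
    using that
  proof (induction k arbitrary: f' g')
    case 0
    then show ?case by (simp cong: continuous_on_cong)
  next
    case (Suc k)
    have diff: "g' differentiable (at x)" if "x \<in> U" for x
    proof -
      have "f' differentiable (at x)" using Suc.prems(1) that by simp
      then obtain D where "(f' has_derivative D) (at x)" unfolding differentiable_def by blast
      then have "(g' has_derivative D) (at x)"
        using assms(1) that Suc.prems(2) by (rule has_derivative_transform_within_open)
      then show ?thesis unfolding differentiable_def by blast
    qed
    have "frechet_derivative f' (at x) v = frechet_derivative g' (at x) v" if "x \<in> U" for x v
      using frechet_derivative_transform_within_open[of f' x U g'] Suc.prems that assms(1) by simp
    then have "Ck_on k U (\<lambda>x. frechet_derivative g' (at x) v)" for v
      using Suc.IH[of "\<lambda>x. frechet_derivative f' (at x) v"] Suc.prems by simp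
    with diff show ?case by simp
  qed
  show ?thesis using imp assms(2) by metis
qed

lemma Ck_on_subset: "Ck_on k U f \<Longrightarrow> V \<subseteq> U \<Longrightarrow> Ck_on k V f"
proof (induction k arbitrary: f)
  case 0
  then show ?case by (auto intro: continuous_on_subset)
next
  case (Suc k)
  then show ?case by auto
qed

lemma Ck_on_pred: "Ck_on (Suc k) U f \<Longrightarrow> Ck_on k U f"
proof (induction k arbitrary: f)
  case 0
  then show ?case
    by (simp add: continuous_at_imp_continuous_on differentiable_imp_continuous_within)
next
  case (Suc k)
  have "Ck_on k U (\<lambda>x. frechet_derivative f (at x) v)" for v
    using Suc.prems by (intro Suc.IH) (simp del: Ck_on.simps add: Ck_on.simps(2)[of "Suc k"])
  moreover have "\<forall>x\<in>U. f differentiable at x"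
    using Suc.prems by simp
  ultimately show ?case by simp
qed

lemma Ck_on_add:
  assumes "open U"
  shows "Ck_on k U f \<Longrightarrow> Ck_on k U g \<Longrightarrow> Ck_on k U (\<lambda>x. f x + g x)"
proof (induction k arbitrary: f g)
  case 0
  then show ?case by (simp add: continuous_on_add)
next
  case (Suc k)
  have der: "((\<lambda>x. f x + g x) has_derivative
      (\<lambda>v. frechet_derivative f (at x) v + frechet_derivative g (at x) v)) (at x)" if "x \<in> U" for x
    using Suc.prems that by (intro has_derivative_add) (simp_all flip: frechet_derivative_works)
  have "Ck_on k U (\<lambda>x. frechet_derivative (\<lambda>x. f x + g x) (at x) v) \<longleftrightarrow>
        Ck_on k U (\<lambda>x. frechet_derivative f (at x) v + frechet_derivative g (at x) v)" for v
    by (intro Ck_on_cong assms) (simp flip: frechet_derivative_at[OF der])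
  moreover have "\<forall>x\<in>U. (\<lambda>x. f x + g x) differentiable at x"
    using der differentiable_def by blast
  ultimately show ?case using Suc by simp
qed

lemma Ck_on_bounded_bilinear:
  assumes "open U" and h: "bounded_bilinear h"
  shows "Ck_on k U f \<Longrightarrow> Ck_on k U g \<Longrightarrow> Ck_on k U (\<lambda>x. h (f x) (g x))"
proof (induction k arbitrary: f g)
  case 0
  then show ?case by (simp add: bounded_bilinear.continuous_on[OF h])
next
  case (Suc k)
  have der: "((\<lambda>x. h (f x) (g x)) has_derivative
      (\<lambda>v. h (f x) (frechet_derivative g (at x) v) + h (frechet_derivative f (at x) v) (g x))) (at x)"
    if "x \<in> U" for x
    using Suc.prems that
    by (intro bounded_bilinear.FDERIV[OF h]) (simp_all flip: frechet_derivative_works)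
  have "Ck_on k U (\<lambda>x. frechet_derivative (\<lambda>x. h (f x) (g x)) (at x) v) \<longleftrightarrow>
      Ck_on k U (\<lambda>x. h (f x) (frechet_derivative g (at x) v) + h (frechet_derivative f (at x) v) (g x))" for v
    by (intro Ck_on_cong assms) (simp flip: frechet_derivative_at[OF der])
  moreover have "Ck_on k U f" "Ck_on k U g"
    using Suc.prems Ck_on_pred by blast+
  ultimately have "Ck_on k U (\<lambda>x. frechet_derivative (\<lambda>x. h (f x) (g x)) (at x) v)" for v
    using Suc.prems by (simp add: Ck_on_add assms(1) Suc.IH)
  moreover have "\<forall>x\<in>U. (\<lambda>x. h (f x) (g x)) differentiable at x"
    using der differentiable_def by blast
  ultimately show ?case by simp
qed

lemma Ck_on_const: "Ck_on k U (\<lambda>_. c)"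
  by (induction k arbitrary: c) simp_all

lemma Ck_on_bounded_linear:
  assumes "bounded_linear L"
  shows "Ck_on k U L"
proof (cases k)
  case 0
  then show ?thesis using assms by (simp add: linear_continuous_on)
next
  case (Suc m)
  have "(L has_derivative L) (at x)" for x
    using assms by (rule bounded_linear_imp_has_derivative)
  then have "L differentiable (at x)" "frechet_derivative L (at x) = L" for x
    using frechet_derivative_at differentiable_def by metis+
  then show ?thesis using Suc by (simp add: Ck_on_const)
qed

text \<open>
  Functions of this shape are closed under differentiation, which gives all orders by induction.
\<close>

lemma Ck_on_trig: "Ck_on k U (\<lambda>t::real. a + sin (c * t) *\<^sub>R b + cos (c * t) *\<^sub>R d)"
proof (induction k arbitrary: a b d)
  case 0
  then show ?case by (auto intro!: continuous_intros)
next
  case (Suc k)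
  have der: "((\<lambda>t::real. a + sin (c * t) *\<^sub>R b + cos (c * t) *\<^sub>R d) has_derivative
      (\<lambda>v. 0 + sin (c * t) *\<^sub>R (- (v * c) *\<^sub>R d) + cos (c * t) *\<^sub>R ((v * c) *\<^sub>R b))) (at t)" for t
    by (auto intro!: derivative_eq_intros simp: algebra_simps)
  have "frechet_derivative (\<lambda>t. a + sin (c * t) *\<^sub>R b + cos (c * t) *\<^sub>R d) (at t) =
      (\<lambda>v. 0 + sin (c * t) *\<^sub>R (- (v * c) *\<^sub>R d) + cos (c * t) *\<^sub>R ((v * c) *\<^sub>R b))" for t
    using frechet_derivative_at[OF der] by simp
  then have "Ck_on k U (\<lambda>t. frechet_derivative
      (\<lambda>t. a + sin (c * t) *\<^sub>R b + cos (c * t) *\<^sub>R d) (at t) v)" for v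
    by (simp only: Suc.IH)
  moreover have "(\<lambda>t. a + sin (c * t) *\<^sub>R b + cos (c * t) *\<^sub>R d) differentiable (at t)" for t
    using der differentiable_def by blast
  ultimately show ?case by simp
qed

lemma smooth_on_subset: "smooth_on M f \<Longrightarrow> N \<subseteq> M \<Longrightarrow> smooth_on N f"
  unfolding smooth_on_def
proof
  fix p
  assume f: "\<forall>p\<in>M. \<exists>U F. open U \<and> p \<in> U \<and> (\<forall>k. Ck_on k U F) \<and> (\<forall>q\<in>M \<inter> U. F q = f q)"
    and "N \<subseteq> M" "p \<in> N"
  then obtain U F where "open U" "p \<in> U" "\<forall>k. Ck_on k U F" "\<forall>q\<in>M \<inter> U. F q = f q"
    by (meson subsetD)
  with \<open>N \<subseteq> M\<close>
  show "\<exists>U F. open U \<and> p \<in> U \<and> (\<forall>k. Ck_on k U F) \<and> (\<forall>q\<in>N \<inter> U. F q = f q)"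
    by (intro exI[of _ U] exI[of _ F]) auto
qed

lemma smooth_on_bounded_linear: "bounded_linear L \<Longrightarrow> smooth_on M L"
  unfolding smooth_on_def using Ck_on_bounded_linear open_UNIV by blast

lemma smooth_on_trig: "smooth_on M (\<lambda>t::real. a + sin (c * t) *\<^sub>R b + cos (c * t) *\<^sub>R d)"
  unfolding smooth_on_def
proof
  fix p
  show "\<exists>U F. open U \<and> p \<in> U \<and> (\<forall>k. Ck_on k U F) \<and>
      (\<forall>t\<in>M \<inter> U. F t = a + sin (c * t) *\<^sub>R b + cos (c * t) *\<^sub>R d)"
    by (intro exI[of _ UNIV] exI[of _ "\<lambda>t. a + sin (c * t) *\<^sub>R b + cos (c * t) *\<^sub>R d"])
      (simp add: Ck_on_trig)
qed

lemma smooth_on_bounded_bilinear: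
  assumes h: "bounded_bilinear h" and f: "smooth_on M f" and g: "smooth_on M g"
  shows "smooth_on M (\<lambda>x. h (f x) (g x))"
  unfolding smooth_on_def
proof
  fix p assume p: "p \<in> M"
  obtain U F where U: "open U" "p \<in> U" "\<forall>k. Ck_on k U F" "\<forall>q\<in>M \<inter> U. F q = f q"
    using f p unfolding smooth_on_def by blast
  obtain V G where V: "open V" "p \<in> V" "\<forall>k. Ck_on k V G" "\<forall>q\<in>M \<inter> V. G q = g q"
    using g p unfolding smooth_on_def by blast
  have "open (U \<inter> V)" using U V by blast
  moreover have "Ck_on k (U \<inter> V) (\<lambda>x. h (F x) (G x))" for k
  proof (rule Ck_on_bounded_bilinear[OF _ h])
    show "open (U \<inter> V)" using U V by blast
    show "Ck_on k (U \<inter> V) F" using U(3) by (auto intro: Ck_on_subset[of k U])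
    show "Ck_on k (U \<inter> V) G" using V(3) by (auto intro: Ck_on_subset[of k V])
  qed
  ultimately show "\<exists>U F. open U \<and> p \<in> U \<and> (\<forall>k. Ck_on k U F) \<and> (\<forall>q\<in>M \<inter> U. F q = h (f q) (g q))"
    using U V by (intro exI[of _ "U \<inter> V"] exI[of _ "\<lambda>x. h (F x) (G x)"]) auto
qed

text \<open>The derivative at \<open>p\<close> of a local smooth extension of \<open>f\<close> is a derivative of \<open>f\<close> within \<open>M\<close>.\<close>

lemma smooth_on_has_derivative:
  assumes "smooth_on M f" and p: "p \<in> M"
  obtains f' where "(f has_derivative f') (at p within M)"
proof -
  obtain U F where U: "open U" "p \<in> U" "\<forall>k. Ck_on k U F" "\<forall>q\<in>M \<inter> U. F q = f q"
    using assms unfolding smooth_on_def by blast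
  have "F differentiable (at p)"
    using U(2) U(3)[rule_format, of "Suc 0"] by simp
  then obtain F' where "(F has_derivative F') (at p within M)"
    unfolding differentiable_def using has_derivative_at_withinI by blast
  moreover have "\<forall>\<^sub>F q in at p within M. F q = f q"
    using U unfolding eventually_at_topological by blast
  ultimately have "(f has_derivative F') (at p within M)"
    by (rule has_derivative_transform_eventually) (use U p in simp_all)
  then show thesis by (rule that)
qed

section \<open>Tangent vectors of the unitary group\<close>

definition conj_transpose :: "complex^'n^'n \<Rightarrow> complex^'n^'n" where
  "conj_transpose A = transpose (map_matrix cnj A)"

definition skew_hermitian :: "(complex^'n^'n) set" where
  "skew_hermitian = {a. conj_transpose a = - a}"

lemma conj_transpose_nth [simp]: "conj_transpose A $ i $ j = cnj (A $ j $ i)"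
  by (simp add: conj_transpose_def transpose_def)

lemma conj_transpose_mult: "conj_transpose (A ** B) = conj_transpose B ** conj_transpose A"
  by (simp add: vec_eq_iff matrix_matrix_mult_def mult.commute)

lemma conj_transpose_conj_transpose [simp]: "conj_transpose (conj_transpose A) = A"
  by (simp add: vec_eq_iff)

lemma conj_transpose_one: "conj_transpose (mat 1) = mat 1"
  by (auto simp: vec_eq_iff mat_def)

lemma bounded_linear_conj_transpose: "bounded_linear conj_transpose"
  unfolding linear_conv_bounded_linear[symmetric]
  by (rule linearI) (simp_all add: vec_eq_iff)

lemma bounded_bilinear_matrix_mult:
  "bounded_bilinear ((**) :: complex^'n^'n \<Rightarrow> complex^'n^'n \<Rightarrow> complex^'n^'n)"
  unfolding bilinear_conv_bounded_bilinear[symmetric] bilinear_def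
  by (auto intro!: linearI
      simp: vec_eq_iff matrix_matrix_mult_def sum.distrib scaleR_sum_right algebra_simps)

lemmas matrix_mult_linear_simps =
  bounded_bilinear.add_left[OF bounded_bilinear_matrix_mult]
  bounded_bilinear.add_right[OF bounded_bilinear_matrix_mult]
  bounded_bilinear.diff_left[OF bounded_bilinear_matrix_mult]
  bounded_bilinear.diff_right[OF bounded_bilinear_matrix_mult]
  bounded_bilinear.minus_left[OF bounded_bilinear_matrix_mult]
  bounded_bilinear.minus_right[OF bounded_bilinear_matrix_mult]
  bounded_bilinear.zero_left[OF bounded_bilinear_matrix_mult]
  bounded_bilinear.zero_right[OF bounded_bilinear_matrix_mult]
  bounded_bilinear.scaleR_left[OF bounded_bilinear_matrix_mult]
  bounded_bilinear.scaleR_right[OF bounded_bilinear_matrix_mult]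

lemmas conj_transpose_linear_simps =
  linear_add[OF bounded_linear.linear[OF bounded_linear_conj_transpose]]
  linear_diff[OF bounded_linear.linear[OF bounded_linear_conj_transpose]]
  linear_neg[OF bounded_linear.linear[OF bounded_linear_conj_transpose]]
  linear_scale[OF bounded_linear.linear[OF bounded_linear_conj_transpose]]

lemma subspace_skew_hermitian: "subspace skew_hermitian"
  unfolding subspace_def skew_hermitian_def
  by (auto simp: conj_transpose_linear_simps linear_0[OF bounded_linear.linear[OF bounded_linear_conj_transpose]])

lemma U3_iff: "A \<in> U3 \<longleftrightarrow> A ** conj_transpose A = mat 1"
  by (simp add: U3_def conj_transpose_def)

lemma U3_cancel:
  assumes "A \<in> U3"
  shows "A ** conj_transpose A = mat 1" "conj_transpose A ** A = mat 1"
    "A ** (conj_transpose A ** B) = B" "conj_transpose A ** (A ** B) = B"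
  using assms matrix_left_right_inverse[of A "conj_transpose A"]
  by (auto simp: U3_iff matrix_mul_assoc)

lemma U3_one: "mat 1 \<in> U3"
  by (simp add: U3_iff conj_transpose_one)

lemma U3_mult:
  assumes "A \<in> U3" "B \<in> U3"
  shows "A ** B \<in> U3"
proof -
  have "(A ** B) ** conj_transpose (A ** B) = A ** ((B ** conj_transpose B) ** conj_transpose A)"
    by (simp add: conj_transpose_mult matrix_mul_assoc)
  then show ?thesis using assms by (simp add: U3_iff)
qed

lemma U3_conj_transpose: "A \<in> U3 \<Longrightarrow> conj_transpose A \<in> U3"
  by (simp add: U3_iff U3_cancel(2))

lemma has_vector_derivative_matrix_mult:
  fixes f g :: "real \<Rightarrow> complex^'n^'n"
  assumes "(f has_vector_derivative f') (at t)" "(g has_vector_derivative g') (at t)"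
  shows "((\<lambda>t. f t ** g t) has_vector_derivative (f t ** g' + f' ** g t)) (at t)"
  using assms by (rule bounded_bilinear.has_vector_derivative[OF bounded_bilinear_matrix_mult])

text \<open>Differentiate \<open>\<gamma>\<^sup>* \<gamma> = 1\<close> along a curve \<open>\<gamma>\<close> with velocity \<open>v\<close> at \<open>A\<close>.\<close>

lemma tangent_U3_imp_skew:
  assumes v: "v \<in> tangent_space U3 A"
  shows "conj_transpose A ** v \<in> skew_hermitian"
proof -
  obtain \<gamma> e where e: "e > 0" and sub: "\<gamma> ` {-e<..<e} \<subseteq> U3" and \<gamma>0: "\<gamma> 0 = A"
    and \<gamma>: "(\<gamma> has_vector_derivative v) (at (0::real))"
    using v unfolding tangent_space_def by blast
  have unit: "mat 1 = conj_transpose (\<gamma> t) ** \<gamma> t" if "t \<in> {-e<..<e}" for t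
    using U3_cancel(2)[of "\<gamma> t"] sub that by (simp add: image_subset_iff)
  have "((\<lambda>t. conj_transpose (\<gamma> t)) has_vector_derivative conj_transpose v) (at 0)"
    by (rule bounded_linear.has_vector_derivative[OF bounded_linear_conj_transpose \<gamma>])
  from has_vector_derivative_matrix_mult[OF this \<gamma>]
  have "((\<lambda>t. conj_transpose (\<gamma> t) ** \<gamma> t) has_vector_derivative
      (conj_transpose A ** v + conj_transpose v ** A)) (at 0)"
    by (simp add: \<gamma>0)
  moreover have "((\<lambda>t. conj_transpose (\<gamma> t) ** \<gamma> t) has_vector_derivative 0) (at 0)"
    by (rule has_vector_derivative_transform_within_open[of "\<lambda>_. mat 1" 0 0 "{-e<..<e}"])
      (use e unit in auto)
  ultimately have "conj_transpose A ** v + conj_transpose v ** A = 0"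
    by (rule vector_derivative_unique_at)
  then show ?thesis
    by (simp add: skew_hermitian_def conj_transpose_mult eq_neg_iff_add_eq_0 add.commute)
qed

text \<open>
  If \<open>\<gamma>\<close> and \<open>\<delta>\<close> are curves through \<open>A\<close> with velocities \<open>u\<close> and \<open>v\<close>, then the curve \<open>\<gamma> A\<^sup>* \<delta>\<close> stays in the
  group, passes through \<open>A\<close> and has velocity \<open>u + v\<close>. Together with one-parameter subgroups
  for the basis vectors this produces every tangent direction without the matrix exponential.
\<close>

lemma tangent_U3_add:
  assumes A: "A \<in> U3" and u: "u \<in> tangent_space U3 A" and v: "v \<in> tangent_space U3 A"
  shows "u + v \<in> tangent_space U3 A"
proof -
  obtain \<gamma> d where d: "d > 0" "smooth_on {-d<..<d} \<gamma>" "\<gamma> ` {-d<..<d} \<subseteq> U3" "\<gamma> 0 = A"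
    and \<gamma>: "(\<gamma> has_vector_derivative u) (at (0::real))"
    using u unfolding tangent_space_def by blast
  obtain \<delta> e where e: "e > 0" "smooth_on {-e<..<e} \<delta>" "\<delta> ` {-e<..<e} \<subseteq> U3" "\<delta> 0 = A"
    and \<delta>: "(\<delta> has_vector_derivative v) (at (0::real))"
    using v unfolding tangent_space_def by blast
  define r where "r = min d e"
  have bl: "bounded_bilinear (\<lambda>(X :: complex^3^3) (Y :: complex^3^3). X ** (conj_transpose A ** Y))"
    by (intro bounded_bilinear.comp[OF bounded_bilinear_matrix_mult]
        bounded_bilinear.bounded_linear_right[OF bounded_bilinear_matrix_mult] bounded_linear_ident)
  let ?\<eta> = "\<lambda>t. \<gamma> t ** (conj_transpose A ** \<delta> t)"
  have "smooth_on {-r<..<r} ?\<eta>"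
    by (intro smooth_on_bounded_bilinear[OF bl] smooth_on_subset[OF d(2)] smooth_on_subset[OF e(2)])
      (auto simp: r_def)
  moreover have "?\<eta> ` {-r<..<r} \<subseteq> U3"
  proof clarify
    fix t assume "t \<in> {-r<..<r}"
    then have "t \<in> {-d<..<d}" "t \<in> {-e<..<e}"
      by (auto simp: r_def min_def split: if_splits)
    then have "\<gamma> t \<in> U3" "\<delta> t \<in> U3"
      using d(3) e(3) by auto
    then show "?\<eta> t \<in> U3" by (intro U3_mult U3_conj_transpose A)
  qed
  moreover have "?\<eta> 0 = A"
    by (simp add: d e U3_cancel[OF A])
  moreover have "(?\<eta> has_vector_derivative (u + v)) (at 0)"
    using bounded_bilinear.has_vector_derivative[OF bl \<gamma> \<delta>]
    by (simp add: d e U3_cancel[OF A] add.commute)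
  moreover have "r > 0" using d e by (simp add: r_def)
  ultimately show ?thesis unfolding tangent_space_def by blast
qed

text \<open>
  When \<open>S\<^sup>3 = - S\<close>, the exponential series of \<open>t S\<close> sums to \<open>1 + sin t S + (1 - cos t) S\<^sup>2\<close>
  (Rodrigues' formula), a curve that is visibly smooth and, for skew-Hermitian \<open>S\<close>, unitary.
  The factor \<open>c\<close> reparametrises it, so that all multiples of \<open>S\<close> are reached.
\<close>

lemma tangent_U3_generator:
  assumes A: "A \<in> U3" and S: "S \<in> skew_hermitian" and S3: "S ** (S ** S) = - S"
  shows "A ** (c *\<^sub>R S) \<in> tangent_space U3 A"
proof -
  define \<eta> where "\<eta> = (\<lambda>t::real. mat 1 + sin (c * t) *\<^sub>R S + (1 - cos (c * t)) *\<^sub>R (S ** S))"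
  let ?\<gamma> = "\<lambda>t. A ** \<eta> t"
  have \<gamma>_eq: "?\<gamma> = (\<lambda>t. (A + A ** (S ** S)) + sin (c * t) *\<^sub>R (A ** S)
      + cos (c * t) *\<^sub>R (- (A ** (S ** S))))"
    by (simp add: \<eta>_def matrix_mult_linear_simps algebra_simps fun_eq_iff)
  have "smooth_on {-1<..<1} ?\<gamma>"
    unfolding \<gamma>_eq by (rule smooth_on_trig)
  moreover have "\<eta> t \<in> U3" for t
  proof -
    define s k where "s = sin (c * t)" and "k = 1 - cos (c * t)"
    have Sc: "conj_transpose S = - S" using S by (simp add: skew_hermitian_def)
    have S4: "S ** (S ** (S ** S)) = - (S ** S)"
      by (simp add: S3 matrix_mult_linear_simps)
    have \<eta>: "\<eta> t = mat 1 + s *\<^sub>R S + k *\<^sub>R (S ** S)"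
      by (simp add: \<eta>_def s_def k_def)
    have ct: "conj_transpose (\<eta> t) = mat 1 - s *\<^sub>R S + k *\<^sub>R (S ** S)"
      by (simp add: \<eta> conj_transpose_linear_simps conj_transpose_mult Sc conj_transpose_one
          matrix_mult_linear_simps)
    \<comment> \<open>The product is \<open>(1 + k S\<^sup>2)\<^sup>2 - (s S)\<^sup>2\<close>, and \<open>S\<^sup>4 = - S\<^sup>2\<close>.\<close>
    have "\<eta> t ** conj_transpose (\<eta> t) = mat 1 + (k + k - k\<^sup>2 - s\<^sup>2) *\<^sub>R (S ** S)"
      unfolding ct unfolding \<eta>
      by (simp add: matrix_mult_linear_simps
          matrix_mul_assoc[symmetric] S3 S4 algebra_simps power2_eq_square)
        (simp add: vec_eq_iff scaleR_conv_of_real)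
    moreover have "k + k - k\<^sup>2 - s\<^sup>2 = 0"
      unfolding s_def k_def using sin_cos_squared_add[of "c * t"]
      by (simp add: power2_eq_square algebra_simps)
    ultimately show ?thesis by (simp add: U3_iff)
  qed
  then have "?\<gamma> ` {-1<..<1} \<subseteq> U3"
    using U3_mult[OF A] by blast
  moreover have "?\<gamma> 0 = A"
    by (simp add: \<eta>_def)
  moreover have "(?\<gamma> has_vector_derivative A ** (c *\<^sub>R S)) (at 0)"
    unfolding \<gamma>_eq has_vector_derivative_def
    by (auto intro!: derivative_eq_intros simp: matrix_mult_linear_simps)
  ultimately show ?thesis
    unfolding tangent_space_def by (intro CollectI exI[of _ ?\<gamma>] exI[of _ 1]) auto
qed

section \<open>The Lie algebra u(3) and its inner product\<close>

definition u3_basis :: "(complex^3^3) set" where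
  "u3_basis =
     {Xmat 1 2, Ymat 1 2, Xmat 1 3, Ymat 1 3, Xmat 2 3, Ymat 2 3, ximat 1, ximat 2, ximat 3}"

lemmas u3_mat_simps =
  vec_eq_iff forall_3 Xmat_def Ymat_def ximat_def Emat_def

lemma u3_basis_skew: "S \<in> u3_basis \<Longrightarrow> S \<in> skew_hermitian"
  unfolding u3_basis_def skew_hermitian_def
  by (auto simp: u3_mat_simps)

lemma u3_basis_cube: "S \<in> u3_basis \<Longrightarrow> S ** (S ** S) = - S"
  unfolding u3_basis_def
  by (elim insertE emptyE) (simp_all add: u3_mat_simps matrix_matrix_mult_def sum_3)

text \<open>
  The real and imaginary parts of the entries above the diagonal, and the imaginary parts on it,
  are the coordinates of a skew-Hermitian matrix.
\<close>

lemma skew_hermitian_eq_span: "skew_hermitian = span u3_basis"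
proof
  show "span u3_basis \<subseteq> skew_hermitian"
    using u3_basis_skew subspace_skew_hermitian by (intro span_minimal) auto
  show "skew_hermitian \<subseteq> span u3_basis"
  proof
    fix a :: "complex^3^3" assume "a \<in> skew_hermitian"
    then have a: "cnj (a $ j $ i) = - a $ i $ j" for i j
      unfolding skew_hermitian_def by (simp add: vec_eq_iff)
    have re: "Re (a $ i $ j) = - Re (a $ j $ i)" and im: "Im (a $ i $ j) = Im (a $ j $ i)" for i j
      using arg_cong[OF a[of j i], of Re] arg_cong[OF a[of j i], of Im] by simp_all
    have diag: "Re (a $ i $ i) = 0" for i using re[of i i] by simp
    have "a = Re (a$1$2) *\<^sub>R Xmat 1 2 + Im (a$1$2) *\<^sub>R Ymat 1 2
            + Re (a$1$3) *\<^sub>R Xmat 1 3 + Im (a$1$3) *\<^sub>R Ymat 1 3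
            + Re (a$2$3) *\<^sub>R Xmat 2 3 + Im (a$2$3) *\<^sub>R Ymat 2 3
            + Im (a$1$1) *\<^sub>R ximat 1 + Im (a$2$2) *\<^sub>R ximat 2 + Im (a$3$3) *\<^sub>R ximat 3"
      using re[of 2 1] re[of 3 1] re[of 3 2] im[of 2 1] im[of 3 1] im[of 3 2]
      by (simp add: u3_mat_simps complex_eq_iff diag)
    also have "\<dots> \<in> span u3_basis"
      by (intro span_add span_scale span_base) (simp_all add: u3_basis_def)
    finally show "a \<in> span u3_basis" .
  qed
qed

text \<open>
  For the converse of \<open>tangent_U3_imp_skew\<close>, each basis vector of \<open>u(3)\<close> generates an explicit curve,
  and sums of tangent vectors are tangent.
\<close>

lemma tangent_space_U3:
  assumes A: "A \<in> U3"
  shows "v \<in> tangent_space U3 A \<longleftrightarrow> conj_transpose A ** v \<in> skew_hermitian"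
proof
  assume "conj_transpose A ** v \<in> skew_hermitian"
  then have "conj_transpose A ** v \<in> span u3_basis"
    by (simp add: skew_hermitian_eq_span)
  then have "A ** (conj_transpose A ** v) \<in> tangent_space U3 A"
  proof (induction rule: span_induct_alt)
    case base
    \<comment> \<open>The zero vector is the multiple 0 of any basis vector.\<close>
    show ?case
      using tangent_U3_generator[OF A u3_basis_skew u3_basis_cube, of "ximat 1" 0]
      by (simp add: u3_basis_def)
  next
    case (step c S y)
    then show ?case
      using tangent_U3_add[OF A tangent_U3_generator[OF A u3_basis_skew u3_basis_cube]]
      by (simp add: matrix_mult_linear_simps)
  qed
  then show "v \<in> tangent_space U3 A"
    by (simp add: U3_cancel[OF A])
qed (rule tangent_U3_imp_skew)

lemma tangent_space_U3_image: "A \<in> U3 \<Longrightarrow> a \<in> skew_hermitian \<Longrightarrow> A ** a \<in> tangent_space U3 A"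
  by (simp add: tangent_space_U3 U3_cancel)

text \<open>
  The inner product on \<open>u(3)\<close> for which \<open>u3_basis\<close> is orthonormal. It is not a multiple of the
  trace form \<open>Re tr (a\<^sup>* b)\<close>, which counts the off-diagonal entries twice. On the diagonal
  the inner product of complex numbers reduces to that of the imaginary parts. The formula is used
  for arbitrary matrices, so that it is a bounded bilinear map on the ambient space.
\<close>

definition u3_inner :: "complex^3^3 \<Rightarrow> complex^3^3 \<Rightarrow> real" where
  "u3_inner a b = a$1$2 \<bullet> b$1$2 + a$1$3 \<bullet> b$1$3 + a$2$3 \<bullet> b$2$3
     + a$1$1 \<bullet> b$1$1 + a$2$2 \<bullet> b$2$2 + a$3$3 \<bullet> b$3$3"

lemma bounded_bilinear_u3_inner: "bounded_bilinear u3_inner"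
  unfolding bilinear_conv_bounded_bilinear[symmetric] bilinear_def
  by (auto intro!: linearI simp: u3_inner_def inner_add_left inner_add_right algebra_simps)

lemmas u3_inner_linear_simps =
  bounded_bilinear.add_left[OF bounded_bilinear_u3_inner]
  bounded_bilinear.add_right[OF bounded_bilinear_u3_inner]
  bounded_bilinear.scaleR_left[OF bounded_bilinear_u3_inner]
  bounded_bilinear.scaleR_right[OF bounded_bilinear_u3_inner]
  bounded_bilinear.zero_left[OF bounded_bilinear_u3_inner]
  bounded_bilinear.zero_right[OF bounded_bilinear_u3_inner]

lemma u3_basis_orthonormal:
  "S \<in> u3_basis \<Longrightarrow> T \<in> u3_basis \<Longrightarrow> u3_inner S T = (if S = T then 1 else 0)"
  unfolding u3_basis_def
  by (elim insertE emptyE) (simp_all add: u3_inner_def u3_mat_simps inner_complex_def)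

text \<open>
  The entry \<open>(i, j)\<close> of \<open>[\<xi>\<^sub>k, a]\<close> is \<open>\<i> (\<delta>\<^sub>i\<^sub>k - \<delta>\<^sub>j\<^sub>k) a\<^sub>i\<^sub>j\<close>, and multiplication by an imaginary number is
  skew-adjoint for the real inner product of the complex plane.
\<close>

lemma ad_ximat_skew_adjoint:
  "u3_inner (ximat k ** a - a ** ximat k) b + u3_inner a (ximat k ** b - b ** ximat k) = 0"
proof -
  have "k = 1 \<or> k = 2 \<or> k = 3" by (rule exhaust_3)
  then show ?thesis
    by (elim disjE) (simp_all add: u3_inner_def ximat_def Emat_def matrix_matrix_mult_def sum_3
        inner_complex_def algebra_simps)
qed

text \<open>
  Both sides are bilinear on \<open>T\<^sub>A U(3) = A u(3)\<close> and agree on the frame. The metric is bilinear on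
  tangent vectors only, so membership in \<open>u(3)\<close> is carried through the induction over the span.
\<close>

lemma metric_eq_u3_inner:
  assumes g: "riemannian_metric U3 g" and on: "frame_orthonormal g" and A: "A \<in> U3"
    and u: "u \<in> tangent_space U3 A" and v: "v \<in> tangent_space U3 A"
  shows "g A u v = u3_inner (conj_transpose A ** u) (conj_transpose A ** v)"
proof -
  note T = tangent_space_U3_image[OF A]
  note sk = subspace_add[OF subspace_skew_hermitian] subspace_scale[OF subspace_skew_hermitian]
    subspace_0[OF subspace_skew_hermitian]
  have sym: "g A x y = g A y x" if "x \<in> tangent_space U3 A" "y \<in> tangent_space U3 A" for x y
    using g A that unfolding riemannian_metric_def by blast
  have add: "g A (x + y) z = g A x z + g A y z"
    if "x \<in> tangent_space U3 A" "y \<in> tangent_space U3 A" "z \<in> tangent_space U3 A" for x y z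
    using g A that unfolding riemannian_metric_def by blast
  have scale: "g A (c *\<^sub>R x) y = c * g A x y"
    if "x \<in> tangent_space U3 A" "y \<in> tangent_space U3 A" for c x y
    using g A that unfolding riemannian_metric_def by blast
  have sym': "u3_inner x y = u3_inner y x" for x y
    by (simp add: u3_inner_def inner_commute)
  have basis: "g A (A ** S) (A ** T) = u3_inner S T" if "S \<in> u3_basis" "T \<in> u3_basis" for S T
  proof -
    \<comment> \<open>Orthonormality compares fields, the inner product compares their values at the identity.\<close>
    have "left_field S = left_field T \<longleftrightarrow> S = T"
      unfolding left_field_def by (metis matrix_mul_lid)
    moreover have "left_field S \<in> frame" "left_field T \<in> frame"
      using that unfolding frame_def u3_basis_def by blast+
    ultimately have "g A (left_field S A) (left_field T A) = (if S = T then 1 else 0)"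
      using on A unfolding frame_orthonormal_def by metis
    then show ?thesis
      by (simp add: left_field_def u3_basis_orthonormal that)
  qed
  have extend: "a \<in> skew_hermitian \<and> g A (A ** a) (A ** b) = u3_inner a b"
    if b: "b \<in> skew_hermitian" and base: "\<And>S. S \<in> u3_basis \<Longrightarrow> g A (A ** S) (A ** b) = u3_inner S b"
      and a: "a \<in> span u3_basis" for a b
    using a
  proof (induction rule: span_induct_alt)
    case base
    then show ?case
      using scale[OF T[OF b] T[OF b], of 0] by (simp add: sk matrix_mult_linear_simps u3_inner_linear_simps)
  next
    case (step c S y)
    have S: "S \<in> skew_hermitian" using step(1) by (rule u3_basis_skew)
    have cS: "c *\<^sub>R (A ** S) \<in> tangent_space U3 A"
      using T[OF sk(2)[OF S, of c]] by (simp add: matrix_mult_linear_simps)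
    show ?case
      using step S b base[OF step(1)]
      by (simp add: sk matrix_mult_linear_simps u3_inner_linear_simps add[OF cS] scale T)
  qed
  have half: "g A (A ** a) (A ** S) = u3_inner a S" if "a \<in> skew_hermitian" "S \<in> u3_basis" for a S
    using extend[of S a] that basis u3_basis_skew by (simp add: skew_hermitian_eq_span)
  have full: "g A (A ** a) (A ** b) = u3_inner a b"
    if "a \<in> skew_hermitian" "b \<in> skew_hermitian" for a b
  proof -
    have "g A (A ** S) (A ** b) = u3_inner S b" if "S \<in> u3_basis" for S
      using half[OF \<open>b \<in> skew_hermitian\<close> that] sym[OF T T] u3_basis_skew[OF that] \<open>b \<in> skew_hermitian\<close> sym'
      by metis
    then show ?thesis using extend[of b a] that by (simp add: skew_hermitian_eq_span)
  qed
  show ?thesis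
    using full[OF tangent_U3_imp_skew[OF u] tangent_U3_imp_skew[OF v]] by (simp add: U3_cancel[OF A])
qed

section \<open>Killing fields\<close>

lemma smooth_vector_field_left_field:
  assumes "\<xi> \<in> skew_hermitian"
  shows "smooth_vector_field U3 (left_field \<xi>)"
  unfolding smooth_vector_field_def left_field_def
  using assms tangent_space_U3_image
  by (auto intro!: smooth_on_bounded_linear bounded_bilinear.bounded_linear_left[OF bounded_bilinear_matrix_mult])

text \<open>
  The derivative of \<open>y(q) = q\<^sup>* Y(q)\<close> along \<open>X(q) = q \<xi>\<close> is \<open>p\<^sup>* DY(X) - \<xi> y\<close>, because \<open>\<xi>\<^sup>* = - \<xi>\<close>, while
  \<open>p\<^sup>* [X, Y] = p\<^sup>* DY(X) - y \<xi>\<close>; the difference is \<open>[\<xi>, y]\<close>. The derivative lies in \<open>u(3)\<close>,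
  which is what makes \<open>[X, Y]\<close> tangent to the group.
\<close>

lemma left_trivialisation_derivative:
  assumes \<xi>: "\<xi> \<in> skew_hermitian" and p: "p \<in> U3" and Y: "smooth_vector_field U3 Y"
  obtains D where
    "((\<lambda>q. conj_transpose q ** Y q) has_derivative D) (at p within U3)"
    and "D (p ** \<xi>) \<in> skew_hermitian"
    and "conj_transpose p ** lie_bracket U3 (left_field \<xi>) Y p =
      D (p ** \<xi>) + (\<xi> ** (conj_transpose p ** Y p) - (conj_transpose p ** Y p) ** \<xi>)"
proof -
  have ps: "p ** \<xi> \<in> tangent_space U3 p" using tangent_space_U3_image[OF p \<xi>] .
  have Ys: "smooth_on U3 Y" and Yt: "\<And>q. q \<in> U3 \<Longrightarrow> Y q \<in> tangent_space U3 q"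
    using Y unfolding smooth_vector_field_def by auto
  obtain Y' where Y': "(Y has_derivative Y') (at p within U3)"
    using smooth_on_has_derivative[OF Ys p] .
  define D where "D v = conj_transpose p ** Y' v + conj_transpose v ** Y p" for v
  have D: "((\<lambda>q. conj_transpose q ** Y q) has_derivative D) (at p within U3)"
    unfolding D_def
    by (rule bounded_bilinear.FDERIV[OF bounded_bilinear_matrix_mult
          bounded_linear_imp_has_derivative[OF bounded_linear_conj_transpose] Y'])
  \<comment> \<open>\<open>u(3)\<close> is the kernel of the linear map \<open>?K\<close>, and \<open>y\<close> takes its values there. Derivatives within
    \<open>U3\<close> are unique only in tangent directions, so the two derivatives of \<open>?K \<circ> y\<close> are compared at \<open>p ** \<xi>\<close>.\<close>
  let ?K = "\<lambda>a::complex^3^3. conj_transpose a + a"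
  have blK: "bounded_linear ?K"
    by (intro bounded_linear_add bounded_linear_conj_transpose bounded_linear_ident)
  have K1: "((\<lambda>q. ?K (conj_transpose q ** Y q)) has_derivative (\<lambda>v. ?K (D v))) (at p within U3)"
    by (rule bounded_linear.has_derivative[OF blK D])
  have K0: "((\<lambda>q. ?K (conj_transpose q ** Y q)) has_derivative (\<lambda>v. 0)) (at p within U3)"
  proof (rule has_derivative_transform[OF p _ has_derivative_const[of 0]])
    fix q assume "q \<in> U3"
    then have "conj_transpose q ** Y q \<in> skew_hermitian"
      using tangent_U3_imp_skew Yt by blast
    then show "?K (conj_transpose q ** Y q) = 0"
      by (simp add: skew_hermitian_def)
  qed
  have "?K (D (p ** \<xi>)) = 0"
    using dir_deriv_eq[OF K1 ps] dir_deriv_eq[OF K0 ps] by simp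
  then have W: "D (p ** \<xi>) \<in> skew_hermitian"
    by (simp add: skew_hermitian_def eq_neg_iff_add_eq_0)
  have X': "(left_field \<xi> has_derivative left_field \<xi>) (at p within U3)"
    unfolding left_field_def
    by (intro bounded_linear_imp_has_derivative
        bounded_bilinear.bounded_linear_left[OF bounded_bilinear_matrix_mult])
  have "lie_bracket U3 (left_field \<xi>) Y p = Y' (p ** \<xi>) - Y p ** \<xi>"
    using dir_deriv_eq[OF Y' ps] dir_deriv_eq[OF X' Yt[OF p]]
    by (simp add: lie_bracket_def left_field_def)
  moreover have "conj_transpose \<xi> = - \<xi>" using \<xi> by (simp add: skew_hermitian_def)
  ultimately have "conj_transpose p ** lie_bracket U3 (left_field \<xi>) Y p =
      D (p ** \<xi>) + (\<xi> ** (conj_transpose p ** Y p) - (conj_transpose p ** Y p) ** \<xi>)"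
    by (simp add: D_def matrix_mult_linear_simps conj_transpose_mult matrix_mul_assoc)
  with D W show thesis by (rule that)
qed

lemma commutator_skew_hermitian:
  "a \<in> skew_hermitian \<Longrightarrow> b \<in> skew_hermitian \<Longrightarrow> a ** b - b ** a \<in> skew_hermitian"
  by (simp add: skew_hermitian_def conj_transpose_linear_simps conj_transpose_mult matrix_mult_linear_simps)

text \<open>
  In \<open>X(g(Y, Z)) - g([X, Y], Z) - g(Y, [X, Z])\<close> the derivatives of \<open>y\<close> and \<open>z\<close> cancel, which leaves the
  two terms with \<open>ad \<xi>\<close>. The formula for \<open>g\<close> applies to the brackets because they are tangent.
\<close>

lemma killing_field_left_field:
  assumes g: "riemannian_metric U3 g" and on: "frame_orthonormal g"
    and \<xi>: "\<xi> \<in> skew_hermitian"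
    and ad: "\<And>a b. u3_inner (\<xi> ** a - a ** \<xi>) b + u3_inner a (\<xi> ** b - b ** \<xi>) = 0"
  shows "killing_field U3 g (left_field \<xi>)"
  unfolding killing_field_def
proof (intro conjI allI impI ballI)
  show "smooth_vector_field U3 (left_field \<xi>)"
    using \<xi> by (rule smooth_vector_field_left_field)
  fix Y Z p
  assume Y: "smooth_vector_field U3 Y" and Z: "smooth_vector_field U3 Z" and p: "p \<in> U3"
  have Yt: "Y q \<in> tangent_space U3 q" and Zt: "Z q \<in> tangent_space U3 q" if "q \<in> U3" for q
    using Y Z that unfolding smooth_vector_field_def by auto
  note G = metric_eq_u3_inner[OF g on]
  define y z where "y = conj_transpose p ** Y p" and "z = conj_transpose p ** Z p"
  have ys: "y \<in> skew_hermitian" and zs: "z \<in> skew_hermitian"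
    unfolding y_def z_def using tangent_U3_imp_skew Yt[OF p] Zt[OF p] by blast+
  obtain D where D: "((\<lambda>q. conj_transpose q ** Y q) has_derivative D) (at p within U3)"
    "D (p ** \<xi>) \<in> skew_hermitian"
    "conj_transpose p ** lie_bracket U3 (left_field \<xi>) Y p = D (p ** \<xi>) + (\<xi> ** y - y ** \<xi>)"
    unfolding y_def using left_trivialisation_derivative[OF \<xi> p Y] .
  obtain E where E: "((\<lambda>q. conj_transpose q ** Z q) has_derivative E) (at p within U3)"
    "E (p ** \<xi>) \<in> skew_hermitian"
    "conj_transpose p ** lie_bracket U3 (left_field \<xi>) Z p = E (p ** \<xi>) + (\<xi> ** z - z ** \<xi>)"
    unfolding z_def using left_trivialisation_derivative[OF \<xi> p Z] .
  have "((\<lambda>q. u3_inner (conj_transpose q ** Y q) (conj_transpose q ** Z q)) has_derivative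
      (\<lambda>v. u3_inner y (E v) + u3_inner (D v) z)) (at p within U3)"
    unfolding y_def z_def by (rule bounded_bilinear.FDERIV[OF bounded_bilinear_u3_inner D(1) E(1)])
  then have "((\<lambda>q. g q (Y q) (Z q)) has_derivative
      (\<lambda>v. u3_inner y (E v) + u3_inner (D v) z)) (at p within U3)"
    by (rule has_derivative_transform[OF p, rotated]) (simp add: G Yt Zt)
  from dir_deriv_eq[OF this tangent_space_U3_image[OF p \<xi>]]
  have 1: "dir_deriv U3 (\<lambda>q. g q (Y q) (Z q)) p (left_field \<xi> p) =
      u3_inner y (E (p ** \<xi>)) + u3_inner (D (p ** \<xi>)) z"
    by (simp add: left_field_def)
  have "lie_bracket U3 (left_field \<xi>) Y p \<in> tangent_space U3 p"
    "lie_bracket U3 (left_field \<xi>) Z p \<in> tangent_space U3 p"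
    unfolding tangent_space_U3[OF p] D(3) E(3)
    by (intro subspace_add[OF subspace_skew_hermitian] D(2) E(2) commutator_skew_hermitian \<xi> ys zs)+
  then have 2: "g p (lie_bracket U3 (left_field \<xi>) Y p) (Z p) =
      u3_inner (D (p ** \<xi>) + (\<xi> ** y - y ** \<xi>)) z"
    and 3: "g p (Y p) (lie_bracket U3 (left_field \<xi>) Z p) =
      u3_inner y (E (p ** \<xi>) + (\<xi> ** z - z ** \<xi>))"
    using G[OF p] Yt[OF p] Zt[OF p] D(3) E(3) by (simp_all add: y_def z_def)
  show "lie_derivative_metric U3 (left_field \<xi>) g Y Z p = 0"
    unfolding lie_derivative_metric_def 1 2 3
    using ad[of y z] by (simp add: u3_inner_linear_simps(1,2))
qed

theorem proposition5p17:
  fixes g :: "complex^3^3 \<Rightarrow> complex^3^3 \<Rightarrow> complex^3^3 \<Rightarrow> real"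
  assumes "riemannian_metric U3 g"
    and "left_invariant_metric g"
    and "frame_orthonormal g"
  shows "killing_field U3 g (left_field (ximat 1)) \<and>
         killing_field U3 g (left_field (ximat 2)) \<and>
         killing_field U3 g (left_field (ximat 3))"
proof -
  have "killing_field U3 g (left_field (ximat k))" if "ximat k \<in> u3_basis" for k
    using assms(1,3) u3_basis_skew[OF that] ad_ximat_skew_adjoint
    by (rule killing_field_left_field)
  then show ?thesis by (simp add: u3_basis_def)
qed

end
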